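(* Let $\mathbf{u} = (u_0, u_1, u_{2+}, u_{2-}) \in \mathbb{R}^4$. Then $\mathbf{u}$ is realizable with respect to the second-order differentiable mixed-moment basis $\mathbf{b}(\mu) = \left(1,\ \mu,\ \mathbb{1}_{[0,1]}(\mu)\,\mu^2,\ \mathbb{1}_{[-1,0]}(\mu)\,\mu^2\right)^T$ on $[-1,1]$, i.e. $\mathbf{u} \in \mathcal{R}_{\mathbf{b}}$, if and only if $$u_0 > 0, \qquad u_{2+} \ge 0, \qquad u_{2-} \ge 0,$$ and $$u_{2+} - \sqrt{u_{2-}\,(u_0 - u_{2+})} \ \le\ u_1 \ \le\ \sqrt{u_{2+}\,(u_0 - u_{2-})} - u_{2-},$$ where the last condition includes the requirement that both square roots are real, i.e. $u_{2-}(u_0 - u_{2+}) \ge 0$ and $u_{2+}(u_0 - u_{2-}) \ge 0$.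
   Context: For a vector of bounded functions $\mathbf{b}:[-1,1]\to\mathbb{R}^n$ (an angular basis), the realizable set is $$\mathcal{R}_{\mathbf{b}} = \left\{ \mathbf{u} \in \mathbb{R}^n : \exists\, \psi \ge 0 \text{ on } [-1,1] \text{ with } \rho = \langle \psi \rangle > 0 \text{ and } \mathbf{u} = \langle \mathbf{b}\,\psi \rangle \right\},$$ where $\langle \cdot \rangle = \int_{-1}^{1} \cdot \, d\mu$, applied componentwise. Here $\psi$ ranges over non-negative distributions on $[-1,1]$ that may contain Dirac deltas; that is, $\psi$ is a non-negative finite Borel measure on $[-1,1]$ and $\langle \mathbf{b}\,\psi\rangle$ means $\int_{[-1,1]} \mathbf{b}(\mu)\, \psi(d\mu)$. A vector $\mathbf{u}\in\mathcal{R}_{\mathbf{b}}$ is called realizable. For the basis in the claim the moments are $u_0 = \int_{[-1,1]} \psi(d\mu)$, $u_1 = \int_{[-1,1]} \mu\, \psi(d\mu)$, $u_{2+} = \int_{[0,1]} \mu^2\, \psi(d\mu)$ and $u_{2-} = \int_{[-1,0]} \mu^2\, \psi(d\mu)$. *)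

theory Defs
  imports "HOL-Analysis.Analysis"
begin

text \<open>A non-negative distribution on the interval from -1 to 1, possibly containing Dirac deltas,
  is a finite Borel measure on that interval.\<close>

definition finite_borel_measure_on_interval :: "real measure \<Rightarrow> bool" where
  "finite_borel_measure_on_interval \<psi> \<longleftrightarrow>
     sets \<psi> = sets (restrict_space borel {-1..1}) \<and> finite_measure \<psi>"

text \<open>The predicate \<open>has_bochner_integral\<close> asserts integrability along with the value of
  the integral; integrability is automatic for a bounded Borel basis, and for any other \<open>b\<close> the
  library's convention that a non-existent integral is 0 plays no role.\<close>

definition realizable_set :: "(real \<Rightarrow> real ^ 'n) \<Rightarrow> (real ^ 'n) set" where
  "realizable_set b =
     {u. \<exists>\<psi>. finite_borel_measure_on_interval \<psi> \<and> measure \<psi> {-1..1} > 0 \<and>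
             (\<forall>i. has_bochner_integral \<psi> (\<lambda>\<mu>. b \<mu> $ i) (u $ i))}"

definition mixed_moment_basis :: "real \<Rightarrow> real ^ 4" where
  "mixed_moment_basis \<mu> =
     vector [1, \<mu>, indicator {0..1} \<mu> * \<mu>\<^sup>2, indicator {-1..0} \<mu> * \<mu>\<^sup>2]"

end

(* Every function in the span of the basis that is non-negative on the interval integrates to a
   non-negative number. For t >= 0, the function equal to (t mu - 1)^2 on [0,1] and to
   1 - mu^2 - 2 t (mu + mu^2) on [-1,0] is of this kind and has the integral
   t^2 u2p + (u0 - u2m) - 2 t (u1 + u2m); optimizing over t yields the upper bound for u1, and the
   lower bound is its mirror image. Conversely, the two bounds are compatible only if
   u2p + u2m <= u0, and then each is attained by a measure with two atoms: the upper one by atoms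
   at -1 and sqrt (u2p / (u0 - u2m)), the lower one by atoms at 1 and - sqrt (u2m / (u0 - u2p)).
   Convex combinations of the two reach every u1 in between. *)
theory Submission
  imports Defs
begin

lemma vector_4 [simp]:
  "(vector [a, b, c, d] :: 'a::zero ^ 4) $ 1 = a"
  "(vector [a, b, c, d] :: 'a::zero ^ 4) $ 2 = b"
  "(vector [a, b, c, d] :: 'a::zero ^ 4) $ 3 = c"
  "(vector [a, b, c, d] :: 'a::zero ^ 4) $ 4 = d"
  by (simp_all add: vector_def)

text \<open>The representing measure is the push-forward under \<open>x\<close> of the point measure
  with weights \<open>w\<close> on the index set. Working over indices lets nodes coincide, in which
  case their weights add up.\<close>

lemma finite_atomic_in_realizable_set:
  fixes x w :: "'i \<Rightarrow> real" and b :: "real \<Rightarrow> real ^ 'n"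
  assumes "finite I" and w: "\<And>k. k \<in> I \<Longrightarrow> w k \<ge> 0" and pos: "sum w I > 0"
    and x: "x \<in> I \<rightarrow> {-1..1}" and b: "\<And>i. (\<lambda>\<mu>. b \<mu> $ i) \<in> borel_measurable borel"
  shows "(\<Sum>k\<in>I. w k *\<^sub>R b (x k)) \<in> realizable_set b"
proof -
  define P where "P = point_measure I w"
  define R where "R = restrict_space (borel :: real measure) {-1..1}"
  define \<psi> where "\<psi> = distr P R x"
  have xm: "x \<in> measurable P R"
    using x by (auto simp: P_def R_def point_measure_def space_restrict_space)
  have bm: "(\<lambda>\<mu>. b \<mu> $ i) \<in> borel_measurable R" for i
    unfolding R_def by (intro measurable_restrict_space1 b)
  have point: "has_bochner_integral P g (\<Sum>k\<in>I. w k *\<^sub>R g k)" for g :: "'i \<Rightarrow> real"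
    unfolding P_def has_bochner_integral_iff
    using assms by (simp add: integrable_point_measure_finite lebesgue_integral_point_measure_finite)
  have integ: "has_bochner_integral \<psi> f (\<Sum>k\<in>I. w k * f (x k))"
    if "f \<in> borel_measurable R" for f :: "real \<Rightarrow> real"
    unfolding \<psi>_def using has_bochner_integral_distr[OF that xm point] by simp
  have space: "space \<psi> = {-1..1}"
    by (simp add: \<psi>_def R_def space_restrict_space)
  have one: "has_bochner_integral \<psi> (\<lambda>_. 1 :: real) (sum w I)"
    using integ[of "\<lambda>_. 1"] by simp
  have "finite_measure P"
    using \<open>finite I\<close> by (auto intro!: finite_measureI
        simp: P_def space_point_measure emeasure_point_measure_finite2 w)
  then have "finite_measure \<psi>"
    unfolding \<psi>_def using xm by (rule finite_measure.finite_measure_distr)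
  moreover have "sets \<psi> = sets (restrict_space borel {-1..1})"
    by (simp add: \<psi>_def R_def)
  moreover have "measure \<psi> {-1..1} = sum w I"
    using one space by (simp add: has_bochner_integral_iff)
  moreover have "has_bochner_integral \<psi> (\<lambda>\<mu>. b \<mu> $ i) ((\<Sum>k\<in>I. w k *\<^sub>R b (x k)) $ i)" for i
    using integ[OF bm] by simp
  ultimately show ?thesis
    using pos unfolding realizable_set_def finite_borel_measure_on_interval_def by auto
qed

text \<open>By linearity the conclusion concerns the integral of a non-negative function. This is
  the easy half of the duality between realizable vectors and non-negative functions in the span of
  \<open>b\<close>.\<close>

lemma realizable_set_nonneg:
  assumes "u \<in> realizable_set b"
    and "\<And>\<mu>. -1 \<le> \<mu> \<Longrightarrow> \<mu> \<le> 1 \<Longrightarrow> 0 \<le> c \<bullet> b \<mu>"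
  shows "0 \<le> c \<bullet> u"
proof -
  obtain \<psi> where sets: "sets \<psi> = sets (restrict_space borel {-1..1})"
    and integ: "\<And>i. has_bochner_integral \<psi> (\<lambda>\<mu>. b \<mu> $ i) (u $ i)"
    using assms(1) by (auto simp: realizable_set_def finite_borel_measure_on_interval_def)
  have space: "space \<psi> = {-1..1}"
    using sets_eq_imp_space_eq[OF sets] by (simp add: space_restrict_space)
  have "has_bochner_integral \<psi> (\<lambda>\<mu>. c \<bullet> b \<mu>) (c \<bullet> u)"
    unfolding inner_vec_def
    by (intro has_bochner_integral_sum) (auto intro!: has_bochner_integral_mult_right integ)
  moreover have "0 \<le> c \<bullet> b \<mu>" if "\<mu> \<in> space \<psi>" for \<mu>
    using that assms(2) space by auto
  ultimately show ?thesis
    by (metis Bochner_Integration.integral_nonneg has_bochner_integral_integral_eq)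
qed

text \<open>The two indicators overlap at 0, but there the factor \<open>\<mu>\<^sup>2\<close>
  vanishes, so the fourth component is 0 on the whole closed half-line.\<close>

lemma mixed_moment_basis_nonneg:
  assumes "0 \<le> \<mu>"
  shows "mixed_moment_basis \<mu> = vector [1, \<mu>, if \<mu> \<le> 1 then \<mu>\<^sup>2 else 0, 0]"
  using assms by (cases "\<mu> = 0") (auto simp: mixed_moment_basis_def indicator_def)

lemma mixed_moment_basis_nonpos:
  assumes "\<mu> \<le> 0"
  shows "mixed_moment_basis \<mu> = vector [1, \<mu>, 0, if -1 \<le> \<mu> then \<mu>\<^sup>2 else 0]"
  using assms by (cases "\<mu> = 0") (auto simp: mixed_moment_basis_def indicator_def)

lemma borel_measurable_mixed_moment_basis:
  "(\<lambda>\<mu>. mixed_moment_basis \<mu> $ i) \<in> borel_measurable borel"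
proof -
  have "\<forall>i. (\<lambda>\<mu>. mixed_moment_basis \<mu> $ i) \<in> borel_measurable borel"
    unfolding forall_4 mixed_moment_basis_def by simp
  then show ?thesis ..
qed

text \<open>The span of the basis consists of pairs of quadratics, one per half of the interval,
  sharing value and slope at 0. Each half can therefore be checked on its own.\<close>

lemma realizable_mixed_moment_nonneg:
  assumes "vector [u0, u1, u2p, u2m] \<in> realizable_set mixed_moment_basis"
    and pos: "\<And>\<mu>. 0 \<le> \<mu> \<Longrightarrow> \<mu> \<le> 1 \<Longrightarrow> 0 \<le> c0 + c1 * \<mu> + c2 * \<mu>\<^sup>2"
    and neg: "\<And>\<mu>. -1 \<le> \<mu> \<Longrightarrow> \<mu> \<le> 0 \<Longrightarrow> 0 \<le> c0 + c1 * \<mu> + c3 * \<mu>\<^sup>2"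
  shows "0 \<le> c0 * u0 + c1 * u1 + c2 * u2p + c3 * u2m"
proof -
  have "0 \<le> vector [c0, c1, c2, c3] \<bullet> mixed_moment_basis \<mu>" if "-1 \<le> \<mu>" "\<mu> \<le> 1" for \<mu>
    using that pos[of \<mu>] neg[of \<mu>]
    by (cases "0 \<le> \<mu>")
      (simp_all add: inner_vec_def sum_4 mixed_moment_basis_nonneg mixed_moment_basis_nonpos)
  from realizable_set_nonneg[OF assms(1) this] show ?thesis
    by (simp add: inner_vec_def sum_4)
qed

text \<open>A discriminant bound for a quadratic in \<open>t\<close> that is controlled only for
  \<open>t \<ge> 0\<close>; this is why the result bounds \<open>c\<close> and not its absolute
  value.\<close>

lemma le_sqrt_mult_if_quadratic_nonneg:
  fixes p q c :: real
  assumes "0 \<le> p" "0 \<le> q" and quad: "\<And>t. 0 \<le> t \<Longrightarrow> 2 * t * c \<le> t\<^sup>2 * p + q"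
  shows "c \<le> sqrt (p * q)"
proof (cases "0 < c")
  case True
  have "p \<noteq> 0"
  proof
    assume "p = 0"
    \<comment> \<open>With \<open>p = 0\<close> this choice of \<open>t\<close> would give
      \<open>2 * (q + 1) \<le> q\<close>.\<close>
    then show False
      using quad[of "(q + 1) / c"] True \<open>0 \<le> q\<close> by simp
  qed
  \<comment> \<open>The value \<open>t = c / p\<close> minimizes
    \<open>t\<^sup>2 * p - 2 * t * c + q\<close>.\<close>
  then have "c\<^sup>2 \<le> p * q"
    using quad[of "c / p"] True \<open>0 \<le> p\<close> by (simp add: field_simps power2_eq_square)
  then show ?thesis
    by (rule real_le_rsqrt)
next
  case False
  then show ?thesis
    using assms by (meson mult_nonneg_nonneg not_less order_trans real_sqrt_ge_zero)
qed

text \<open>An atom of mass \<open>a\<close> at \<open>sqrt (p / a)\<close> has second moment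
  \<open>p\<close> and first moment \<open>sqrt (p * a)\<close>. If \<open>a = 0\<close>, then
  \<open>p = 0\<close> as well, and the convention \<open>p / 0 = 0\<close> keeps the equations
  true.\<close>

lemma sqrt_ratio_atom:
  fixes p a :: real
  assumes "0 \<le> p" "p \<le> a"
  shows "sqrt (p / a) \<le> 1" "a * sqrt (p / a) = sqrt (p * a)" "a * (sqrt (p / a))\<^sup>2 = p"
proof -
  show "sqrt (p / a) \<le> 1"
    using assms by (auto simp: divide_le_eq_1)
  show "a * (sqrt (p / a))\<^sup>2 = p"
    using assms by auto
  show "a * sqrt (p / a) = sqrt (p * a)"
  proof (cases "a = 0")
    case False
    then show ?thesis
      using assms by (simp add: real_sqrt_divide real_sqrt_mult field_simps)
  qed simp
qed

lemma realizable_mixed_moment_necessary: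
  assumes u: "vector [u0, u1, u2p, u2m] \<in> realizable_set mixed_moment_basis"
  shows "0 < u0" "0 \<le> u2p" "0 \<le> u2m" "u2p \<le> u0" "u2m \<le> u0"
    "u2p - sqrt (u2m * (u0 - u2p)) \<le> u1" "u1 \<le> sqrt (u2p * (u0 - u2m)) - u2m"
proof -
  note nonneg = realizable_mixed_moment_nonneg[OF u]
  show "0 < u0"
  proof -
    \<comment> \<open>Test functions yield only weak inequalities, so strictness is taken from the
      total mass, which is the first moment component.\<close>
    obtain \<psi> where sets: "sets \<psi> = sets (restrict_space borel {-1..1})"
      and pos: "0 < measure \<psi> {-1..1}"
      and integ: "\<And>i. has_bochner_integral \<psi> (\<lambda>\<mu>. mixed_moment_basis \<mu> $ i)
        (vector [u0, u1, u2p, u2m] $ i)"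
      using u by (auto simp: realizable_set_def finite_borel_measure_on_interval_def)
    have "space \<psi> = {-1..1}"
      using sets_eq_imp_space_eq[OF sets] by (simp add: space_restrict_space)
    then show ?thesis
      using pos integ[of 1] by (simp add: mixed_moment_basis_def has_bochner_integral_iff)
  qed
  have sq: "\<mu>\<^sup>2 \<le> 1" if "-1 \<le> \<mu>" "\<mu> \<le> 1" for \<mu> :: real
    using that by (simp add: abs_square_le_1 abs_le_iff)
  have abs_sq: "\<mu>\<^sup>2 \<le> \<bar>\<mu>\<bar>" if "-1 \<le> \<mu>" "\<mu> \<le> 1" for \<mu> :: real
    using mult_left_le[of "\<bar>\<mu>\<bar>" "\<bar>\<mu>\<bar>"] that by (simp add: power2_eq_square abs_le_iff)
  show p: "0 \<le> u2p" using nonneg[of 0 0 1 0] by simp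
  show m: "0 \<le> u2m" using nonneg[of 0 0 0 1] by simp
  \<comment> \<open>One minus a quadratic basis function is non-negative. These two bounds make the
    radicands non-negative.\<close>
  show pu: "u2p \<le> u0" using nonneg[of 1 0 "-1" 0] sq by simp
  show mu: "u2m \<le> u0" using nonneg[of 1 0 0 "-1"] sq by simp
  have "u1 + u2m \<le> sqrt (u2p * (u0 - u2m))"
  proof (rule le_sqrt_mult_if_quadratic_nonneg)
    fix t :: real assume t: "0 \<le> t"
    have "0 \<le> 1 * u0 + (- 2 * t) * u1 + t\<^sup>2 * u2p + (- 1 - 2 * t) * u2m"
    proof (rule nonneg)
      fix \<mu> :: real
      show "0 \<le> 1 + - 2 * t * \<mu> + t\<^sup>2 * \<mu>\<^sup>2"
        using zero_le_power2[of "t * \<mu> - 1"] by (simp add: power2_eq_square algebra_simps)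
      assume \<mu>: "-1 \<le> \<mu>" "\<mu> \<le> 0"
      \<comment> \<open>On the negative half the test function is \<open>1 - \<mu>\<^sup>2\<close>
        minus twice this product.\<close>
      then have "t * (\<mu> + \<mu>\<^sup>2) \<le> 0"
        using t abs_sq[of \<mu>] by (intro mult_nonneg_nonpos) auto
      then show "0 \<le> 1 + - 2 * t * \<mu> + (- 1 - 2 * t) * \<mu>\<^sup>2"
        using sq[of \<mu>] \<mu> by (simp add: algebra_simps)
    qed
    then show "2 * t * (u1 + u2m) \<le> t\<^sup>2 * u2p + (u0 - u2m)"
      by (simp add: algebra_simps)
  qed (use p mu in auto)
  then show "u1 \<le> sqrt (u2p * (u0 - u2m)) - u2m" by simp
  have "u2p - u1 \<le> sqrt (u2m * (u0 - u2p))"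
  proof (rule le_sqrt_mult_if_quadratic_nonneg)
    fix t :: real assume t: "0 \<le> t"
    \<comment> \<open>The reflection of the previous test function:
      \<open>(t * \<mu> + 1)\<^sup>2\<close> on the negative half and
      \<open>1 - \<mu>\<^sup>2 + 2 * t * (\<mu> - \<mu>\<^sup>2)\<close> on the positive
      half.\<close>
    have "0 \<le> 1 * u0 + (2 * t) * u1 + (- 1 - 2 * t) * u2p + t\<^sup>2 * u2m"
    proof (rule nonneg)
      fix \<mu> :: real
      show "0 \<le> 1 + 2 * t * \<mu> + t\<^sup>2 * \<mu>\<^sup>2"
        using zero_le_power2[of "t * \<mu> + 1"] by (simp add: power2_eq_square algebra_simps)
      assume \<mu>: "0 \<le> \<mu>" "\<mu> \<le> 1"
      then have "t * (\<mu>\<^sup>2 - \<mu>) \<le> 0"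
        using t abs_sq[of \<mu>] by (intro mult_nonneg_nonpos) auto
      then show "0 \<le> 1 + 2 * t * \<mu> + (- 1 - 2 * t) * \<mu>\<^sup>2"
        using sq[of \<mu>] \<mu> by (simp add: algebra_simps)
    qed
    then show "2 * t * (u2p - u1) \<le> t\<^sup>2 * u2m + (u0 - u2p)"
      by (simp add: algebra_simps)
  qed (use m pu in auto)
  then show "u2p - sqrt (u2m * (u0 - u2p)) \<le> u1" by simp
qed

lemma realizable_mixed_moment_sufficient:
  assumes "0 < u0" "0 \<le> u2p" "0 \<le> u2m" "u2p + u2m \<le> u0"
    and lower: "u2p - sqrt (u2m * (u0 - u2p)) \<le> u1"
    and upper: "u1 \<le> sqrt (u2p * (u0 - u2m)) - u2m"
  shows "vector [u0, u1, u2p, u2m] \<in> realizable_set mixed_moment_basis"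
proof -
  define L where "L = u2p - sqrt (u2m * (u0 - u2p))"
  define U where "U = sqrt (u2p * (u0 - u2m)) - u2m"
  have "u1 \<in> closed_segment L U"
    using lower upper by (simp add: L_def U_def closed_segment_eq_real_ivl)
  then obtain s where s: "0 \<le> s" "s \<le> 1" and u1: "u1 = (1 - s) * L + s * U"
    by (auto simp: in_segment)
  \<comment> \<open>For the lower bound, mass \<open>u2p\<close> at 1 supplies all of
    \<open>u2p\<close>; the remaining mass \<open>u0 - u2p\<close> must then yield
    \<open>u2m\<close> from the single node \<open>- y\<close>. The node \<open>z\<close> arises
    symmetrically. The assumption \<open>u2p + u2m \<le> u0\<close> keeps both nodes in the
    interval.\<close>
  define y where "y = sqrt (u2m / (u0 - u2p))"
  define z where "z = sqrt (u2p / (u0 - u2m))"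
  have yz0: "0 \<le> y" "0 \<le> z"
    using assms by (simp_all add: y_def z_def)
  have y: "y \<le> 1" "(u0 - u2p) * y = sqrt (u2m * (u0 - u2p))" "(u0 - u2p) * y\<^sup>2 = u2m"
    unfolding y_def using assms by (intro sqrt_ratio_atom; simp)+
  have z: "z \<le> 1" "(u0 - u2m) * z = sqrt (u2p * (u0 - u2m))" "(u0 - u2m) * z\<^sup>2 = u2p"
    unfolding z_def using assms by (intro sqrt_ratio_atom; simp)+
  \<comment> \<open>The first two atoms attain the lower bound and carry the factor
    \<open>1 - s\<close>; the last two attain the upper bound and carry \<open>s\<close>.\<close>
  define w where "w = (!) [(1 - s) * u2p, (1 - s) * (u0 - u2p), s * u2m, s * (u0 - u2m)]"
  define x where "x = (!) [1, - y, - 1, z]"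
  have four: "{..<4::nat} = {0, 1, 2, 3}" by auto
  have sum: "sum w {..<4} = u0"
    by (simp add: four w_def algebra_simps)
  have "(\<Sum>k<4. w k *\<^sub>R mixed_moment_basis (x k)) \<in> realizable_set mixed_moment_basis"
  proof (rule finite_atomic_in_realizable_set)
    show "0 \<le> w k" if "k \<in> {..<4}" for k
      using that s assms by (auto simp: four w_def)
    show "x \<in> {..<4} \<rightarrow> {-1..1}"
      using y(1) z(1) yz0 by (auto simp: four x_def)
  qed (use sum \<open>0 < u0\<close> borel_measurable_mixed_moment_basis in auto)
  also have "(\<Sum>k<4. w k *\<^sub>R mixed_moment_basis (x k)) = vector [u0, u1, u2p, u2m]"
  proof -
    have "u1 = (1 - s) * u2p - (1 - s) * ((u0 - u2p) * y) - s * u2m + s * ((u0 - u2m) * z)"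
      unfolding u1 L_def U_def y(2) z(2) by (simp add: algebra_simps)
    moreover have "u2p = (1 - s) * u2p + s * ((u0 - u2m) * z\<^sup>2)"
      unfolding z(3) by (simp add: algebra_simps)
    moreover have "u2m = (1 - s) * ((u0 - u2p) * y\<^sup>2) + s * u2m"
      unfolding y(3) by (simp add: algebra_simps)
    ultimately show ?thesis
      using y(1) z(1) yz0 sum unfolding vec_eq_iff forall_4
      by (simp add: four w_def x_def mixed_moment_basis_nonneg mixed_moment_basis_nonpos
          mult.assoc)
  qed
  finally show ?thesis .
qed

text \<open>If \<open>u0 < p + m\<close>, then \<open>u0 - p < m\<close> and
  \<open>u0 - m < p\<close>, so the roots are at most \<open>m\<close> and \<open>p\<close>. The
  lower bound is then at least \<open>p - m\<close> and the upper at most \<open>p - m\<close>,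
  which forces equality throughout.\<close>

lemma sum_le_of_sqrt_bounds:
  fixes u0 p m :: real
  assumes "0 < u0" "0 \<le> p" "0 \<le> m" "0 \<le> m * (u0 - p)" "0 \<le> p * (u0 - m)"
    and bounds: "p - sqrt (m * (u0 - p)) \<le> sqrt (p * (u0 - m)) - m"
  shows "p + m \<le> u0"
proof (rule ccontr)
  assume "\<not> p + m \<le> u0"
  then have gt: "u0 < p + m" by simp
  have "sqrt (m * (u0 - p)) \<le> m"
    using assms gt by (intro real_le_lsqrt) (auto simp: power2_eq_square intro: mult_left_mono)
  moreover have "sqrt (p * (u0 - m)) \<le> p"
    using assms gt by (intro real_le_lsqrt) (auto simp: power2_eq_square intro: mult_left_mono)
  ultimately have "sqrt (m * (u0 - p)) = m" "sqrt (p * (u0 - m)) = p"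
    using bounds by linarith+
  then have "m * (u0 - p) = m * m" "p * (u0 - m) = p * p"
    using assms(4,5) by (metis real_sqrt_mult_self abs_of_nonneg)+
  \<comment> \<open>Since \<open>u0 - p\<close> differs from \<open>m\<close> and
    \<open>u0 - m\<close> from \<open>p\<close>, the common factors must vanish.\<close>
  then have "m = 0" "p = 0"
    using gt by auto
  then show False
    using gt \<open>0 < u0\<close> by simp
qed

theorem theorem3p3:
  fixes u\<^sub>0 u\<^sub>1 u\<^sub>2\<^sub>p u\<^sub>2\<^sub>m :: real
  shows "(vector [u\<^sub>0, u\<^sub>1, u\<^sub>2\<^sub>p, u\<^sub>2\<^sub>m] :: real ^ 4) \<in> realizable_set mixed_moment_basis \<longleftrightarrow>
    u\<^sub>0 > 0 \<and> u\<^sub>2\<^sub>p \<ge> 0 \<and> u\<^sub>2\<^sub>m \<ge> 0 \<and>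
    u\<^sub>2\<^sub>m * (u\<^sub>0 - u\<^sub>2\<^sub>p) \<ge> 0 \<and> u\<^sub>2\<^sub>p * (u\<^sub>0 - u\<^sub>2\<^sub>m) \<ge> 0 \<and>
    u\<^sub>2\<^sub>p - sqrt (u\<^sub>2\<^sub>m * (u\<^sub>0 - u\<^sub>2\<^sub>p)) \<le> u\<^sub>1 \<and>
    u\<^sub>1 \<le> sqrt (u\<^sub>2\<^sub>p * (u\<^sub>0 - u\<^sub>2\<^sub>m)) - u\<^sub>2\<^sub>m"
proof
  assume "vector [u\<^sub>0, u\<^sub>1, u\<^sub>2\<^sub>p, u\<^sub>2\<^sub>m] \<in> realizable_set mixed_moment_basis"
  from realizable_mixed_moment_necessary[OF this]
  show "u\<^sub>0 > 0 \<and> u\<^sub>2\<^sub>p \<ge> 0 \<and> u\<^sub>2\<^sub>m \<ge> 0 \<and>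
    u\<^sub>2\<^sub>m * (u\<^sub>0 - u\<^sub>2\<^sub>p) \<ge> 0 \<and> u\<^sub>2\<^sub>p * (u\<^sub>0 - u\<^sub>2\<^sub>m) \<ge> 0 \<and>
    u\<^sub>2\<^sub>p - sqrt (u\<^sub>2\<^sub>m * (u\<^sub>0 - u\<^sub>2\<^sub>p)) \<le> u\<^sub>1 \<and>
    u\<^sub>1 \<le> sqrt (u\<^sub>2\<^sub>p * (u\<^sub>0 - u\<^sub>2\<^sub>m)) - u\<^sub>2\<^sub>m"
    by simp
\<comment> \<open>Chaining the two bounds through \<open>u\<^sub>1\<close> gives the compatibility
  from which the bound on the sum of the second moments follows.\<close>
qed (blast intro: realizable_mixed_moment_sufficient sum_le_of_sqrt_bounds order_trans)

end
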